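(* Fix real numbers $c<d$. None of the topological spaces $\mathrm{(ffid^{[c,d]})}$, $\mathrm{(ffid)}$, $\mathrm{(fid)}$, $\mathrm{(cfid)}$, $\mathrm{(cid)}$, $\mathrm{(pfd)}$, $\mathrm{(rid)}$, with the topology induced by the interleaving distance, is locally compact.
   Context: Fix a field $\mathbf{k}$. A persistence module is a functor $M:(\mathbb{R},\le)\to \mathrm{Vect}_{\mathbf{k}}$; "persistence module" means isomorphism class. For an interval $J\subset\mathbb{R}$, the interval module $J$ is $\mathbf{k}$ at points of $J$ and $0$ elsewhere, with identity maps between points of $J$ and zero maps otherwise. For $\varepsilon\ge 0$, $M,N$ are $\varepsilon$-interleaved if there are families of linear maps $\varphi_a:M(a)\to N(a+\varepsilon)$ and $\psi_a:N(a)\to M(a+\varepsilon)$, natural in $a\in\mathbb{R}$, with $\psi_{a+\varepsilon}\varphi_a=M(a\le a+2\varepsilon)$ and $\varphi_{a+\varepsilon}\psi_a=N(a\le a+2\varepsilon)$ for all $a$. The interleaving distance is $d_I(M,N)=\inf\{\varepsilon\ge0 : M,N \text{ are } \varepsilon\text{-interleaved}\}$ ($\infty$ if there is none). It is an extended pseudometric; the induced topology has the open balls $B_r(M)=\{N: d_I(M,N)<r\}$, $r>0$, as a base. Sets of persistence modules: $\mathrm{(fid)}$: finite direct sums of interval modules (including the zero module); $\mathrm{(ffid)}$: those in $\mathrm{(fid)}$ with all intervals finite (bounded); $\mathrm{(ffid^{[c,d]})}$: those in $\mathrm{(ffid)}$ with all intervals contained in $[c,d]$; $\mathrm{(cid)}$: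 direct sums of countably many interval modules; $\mathrm{(cfid)}$: those in $\mathrm{(cid)}$ with all intervals finite (bounded); $\mathrm{(pfd)}$: persistence modules $M$ with every $M(a)$ finite dimensional; $\mathrm{(rid)}$: direct sums $\bigoplus_{\alpha\in A}I_\alpha$ of interval modules with $|A|\le|\mathbb{R}|$. A topological space is locally compact if each point has a compact neighborhood, where a neighborhood of $p$ is a subset $V$ for which there is an open set $U$ with $p\in U\subset V$; compact means every open cover has a finite subcover. *)

theory Defs
  imports "HOL-Analysis.Analysis" "HOL-Library.Function_Algebras"
begin

text \<open>
  The field is a type \<open>'k::field\<close>.  Vector spaces over it are subspaces (in the sense of
  \<open>module.subspace\<close>) of an ambient vector space given by a type \<open>'v\<close> with a scalar
  multiplication \<open>s :: 'k \<Rightarrow> 'v \<Rightarrow> 'v\<close>.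
\<close>

definition linear_between ::
  "('k::field \<Rightarrow> 'v::ab_group_add \<Rightarrow> 'v) \<Rightarrow> ('k \<Rightarrow> 'w::ab_group_add \<Rightarrow> 'w) \<Rightarrow>
     'v set \<Rightarrow> 'w set \<Rightarrow> ('v \<Rightarrow> 'w) \<Rightarrow> bool" where
  "linear_between s t V W f \<longleftrightarrow>
     f ` V \<subseteq> W \<and>
     (\<forall>x\<in>V. \<forall>y\<in>V. f (x + y) = f x + f y) \<and>
     (\<forall>c. \<forall>x\<in>V. f (s c x) = t c (f x))"


subsection \<open>Persistence modules\<close>

text \<open>\<open>obj M a\<close> is the vector space $M(a)$ and \<open>arr M a b\<close> is the map $M(a \le b)$; the value of
  \<open>arr M a b\<close> is irrelevant outside \<open>obj M a\<close> and when \<open>b < a\<close>.\<close>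

record 'v pmod =
  obj :: "real \<Rightarrow> 'v set"
  arr :: "real \<Rightarrow> real \<Rightarrow> 'v \<Rightarrow> 'v"

definition persistence_module ::
  "('k::field \<Rightarrow> 'v::ab_group_add \<Rightarrow> 'v) \<Rightarrow> 'v pmod \<Rightarrow> bool" where
  "persistence_module s M \<longleftrightarrow>
     (\<forall>a. module.subspace s (obj M a)) \<and>
     (\<forall>a b. a \<le> b \<longrightarrow> linear_between s s (obj M a) (obj M b) (arr M a b)) \<and>
     (\<forall>a. \<forall>x\<in>obj M a. arr M a a x = x) \<and>
     (\<forall>a b c. a \<le> b \<longrightarrow> b \<le> c \<longrightarrow> (\<forall>x\<in>obj M a. arr M b c (arr M a b x) = arr M a c x))"

definition shift :: "real \<Rightarrow> 'v pmod \<Rightarrow> 'v pmod" where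
  "shift e M = \<lparr>obj = (\<lambda>a. obj M (a + e)), arr = (\<lambda>a b. arr M (a + e) (b + e))\<rparr>"

definition pmod_morphism ::
  "('k::field \<Rightarrow> 'v::ab_group_add \<Rightarrow> 'v) \<Rightarrow> ('k \<Rightarrow> 'w::ab_group_add \<Rightarrow> 'w) \<Rightarrow>
     'v pmod \<Rightarrow> 'w pmod \<Rightarrow> (real \<Rightarrow> 'v \<Rightarrow> 'w) \<Rightarrow> bool" where
  "pmod_morphism s t M N \<phi> \<longleftrightarrow>
     (\<forall>a. linear_between s t (obj M a) (obj N a) (\<phi> a)) \<and>
     (\<forall>a b. a \<le> b \<longrightarrow> (\<forall>x\<in>obj M a. \<phi> b (arr M a b x) = arr N a b (\<phi> a x)))"

definition pmod_isomorphic ::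
  "('k::field \<Rightarrow> 'v::ab_group_add \<Rightarrow> 'v) \<Rightarrow> ('k \<Rightarrow> 'w::ab_group_add \<Rightarrow> 'w) \<Rightarrow>
     'v pmod \<Rightarrow> 'w pmod \<Rightarrow> bool" where
  "pmod_isomorphic s t M N \<longleftrightarrow>
     (\<exists>\<phi>. pmod_morphism s t M N \<phi> \<and> (\<forall>a. bij_betw (\<phi> a) (obj M a) (obj N a)))"

definition interleaved ::
  "('k::field \<Rightarrow> 'v::ab_group_add \<Rightarrow> 'v) \<Rightarrow> ('k \<Rightarrow> 'w::ab_group_add \<Rightarrow> 'w) \<Rightarrow>
     real \<Rightarrow> 'v pmod \<Rightarrow> 'w pmod \<Rightarrow> bool" where
  "interleaved s t e M N \<longleftrightarrow>
     (\<exists>\<phi> \<psi>. pmod_morphism s t M (shift e N) \<phi> \<and>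
            pmod_morphism t s N (shift e M) \<psi> \<and>
            (\<forall>a. \<forall>x\<in>obj M a. \<psi> (a + e) (\<phi> a x) = arr M a (a + 2 * e) x) \<and>
            (\<forall>a. \<forall>y\<in>obj N a. \<phi> (a + e) (\<psi> a y) = arr N a (a + 2 * e) y))"


subsection \<open>Interval modules and direct sums\<close>

definition interval_module :: "real set \<Rightarrow> 'k::field pmod" where
  "interval_module J =
     \<lparr>obj = (\<lambda>a. if a \<in> J then UNIV else {0}),
      arr = (\<lambda>a b x. if a \<in> J \<and> b \<in> J then x else 0)\<rparr>"

definition fun_scale :: "('k \<Rightarrow> 'v \<Rightarrow> 'v) \<Rightarrow> 'k \<Rightarrow> ('i \<Rightarrow> 'v) \<Rightarrow> 'i \<Rightarrow> 'v" where
  "fun_scale s c f = (\<lambda>i. s c (f i))"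

definition direct_sum :: "'i set \<Rightarrow> ('i \<Rightarrow> 'v::zero pmod) \<Rightarrow> ('i \<Rightarrow> 'v) pmod" where
  "direct_sum A M =
     \<lparr>obj = (\<lambda>a. {f. (\<forall>i\<in>A. f i \<in> obj (M i) a) \<and> (\<forall>i. i \<notin> A \<longrightarrow> f i = 0) \<and>
                     finite {i. f i \<noteq> 0}}),
      arr = (\<lambda>a b f i. if i \<in> A then arr (M i) a b (f i) else 0)\<rparr>"


subsection \<open>Isomorphism classes and the interleaving distance\<close>

text \<open>
  As HOL has no class of all vector spaces, isomorphism classes are formed among the persistence
  modules whose values are subspaces of the fixed vector space of all functions
  \<open>real \<Rightarrow> 'k\<close>.  Its dimension is at least $|\mathbb{R}|$, so every pointwise finite dimensional
  module, and every direct sum of at most $|\mathbb{R}|$ interval modules (index it by a set of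
  reals), is isomorphic to one of these.
\<close>

abbreviation uscale :: "'k::field \<Rightarrow> (real \<Rightarrow> 'k) \<Rightarrow> real \<Rightarrow> 'k" where
  "uscale \<equiv> fun_scale (*)"

type_synonym 'k pclass = "(real \<Rightarrow> 'k) pmod set"

definition iso_rel :: "((real \<Rightarrow> 'k::field) pmod \<times> (real \<Rightarrow> 'k) pmod) set" where
  "iso_rel = {(M, N). persistence_module uscale M \<and> persistence_module uscale N \<and>
                      pmod_isomorphic uscale uscale M N}"

definition iso_class :: "(real \<Rightarrow> 'k::field) pmod \<Rightarrow> 'k pclass" where
  "iso_class M = iso_rel `` {M}"

definition interleaving_dist :: "'k::field pclass \<Rightarrow> 'k pclass \<Rightarrow> ereal" where
  "interleaving_dist C D =
     Inf {ereal e | e. 0 \<le> e \<and> (\<exists>M\<in>C. \<exists>N\<in>D. interleaved uscale uscale e M N)}"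

text \<open>By the triangle inequality the balls are a base, not only a subbase, of this topology.\<close>

definition interleaving_topology :: "'k::field pclass set \<Rightarrow> 'k pclass topology" where
  "interleaving_topology X =
     topology_generated_by {{D \<in> X. interleaving_dist C D < ereal r} | C r. C \<in> X \<and> 0 < r}"


subsection \<open>The sets of persistence modules\<close>

text \<open>Classes of the direct sums, over index sets satisfying \<open>Q\<close>, of interval modules whose
  intervals satisfy \<open>P\<close>.\<close>

definition interval_sums ::
  "(real set \<Rightarrow> bool) \<Rightarrow> (real set \<Rightarrow> bool) \<Rightarrow> 'k::field pclass set" where
  "interval_sums Q P =
     {iso_class (direct_sum A (\<lambda>i. interval_module (J i))) | A J.
        Q A \<and> (\<forall>i\<in>A. is_interval (J i) \<and> J i \<noteq> {} \<and> P (J i))}"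

definition fid :: "'k::field pclass set" where
  "fid = interval_sums finite (\<lambda>_. True)"

definition ffid :: "'k::field pclass set" where
  "ffid = interval_sums finite bounded"

definition ffid_within :: "real \<Rightarrow> real \<Rightarrow> 'k::field pclass set" where
  "ffid_within c d = interval_sums finite (\<lambda>J. bounded J \<and> J \<subseteq> {c..d})"

definition cid :: "'k::field pclass set" where
  "cid = interval_sums countable (\<lambda>_. True)"

definition cfid :: "'k::field pclass set" where
  "cfid = interval_sums countable bounded"

definition pfd :: "'k::field pclass set" where
  "pfd = {iso_class M | M. persistence_module uscale M \<and>
            (\<forall>a. \<exists>B. finite B \<and> obj M a \<subseteq> module.span uscale B)}"

text \<open>The condition $|A| \le |\mathbb{R}|$ on the index set is built into its type.\<close>

definition rid :: "'k::field pclass set" where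
  "rid = interval_sums (\<lambda>_. True) (\<lambda>_. True)"


subsection \<open>Well-definedness\<close>

lemma vector_space_fun_scale:
  assumes "vector_space s"
  shows "vector_space (fun_scale s :: _ \<Rightarrow> ('i \<Rightarrow> _) \<Rightarrow> _)"
proof -
  interpret vector_space s by fact
  show ?thesis
    by unfold_locales
      (simp_all add: fun_scale_def fun_eq_iff scale_right_distrib scale_left_distrib)
qed

lemma module_fun_scale:
  "vector_space s \<Longrightarrow> module (fun_scale s :: _ \<Rightarrow> ('i \<Rightarrow> _) \<Rightarrow> _)"
  using vector_space_fun_scale module_iff_vector_space by blast

lemma persistence_module_interval:
  fixes J :: "real set"
  assumes "is_interval J"
  shows "persistence_module (*) (interval_module J :: 'k::field pmod)"
proof -
  have conv: "b \<in> J" if "a \<in> J" "c \<in> J" "a \<le> b" "b \<le> c" for a b c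
    using assms that unfolding is_interval_1 by blast
  show ?thesis
    unfolding persistence_module_def
  proof (intro conjI allI ballI impI)
    fix a
    show "module.subspace (*) (obj (interval_module J :: 'k pmod) a)"
      by (simp add: interval_module_def)
  next
    fix a b :: real
    show "linear_between (*) (*) (obj (interval_module J :: 'k pmod) a)
            (obj (interval_module J) b) (arr (interval_module J) a b)"
      by (simp add: interval_module_def linear_between_def)
  next
    fix a and x :: 'k assume "x \<in> obj (interval_module J) a"
    then show "arr (interval_module J) a a x = x"
      by (simp add: interval_module_def split: if_splits)
  next
    fix a b c :: real and x :: 'k assume "a \<le> b" "b \<le> c"
    then show "arr (interval_module J) b c (arr (interval_module J) a b x)
                 = arr (interval_module J) a c x"
      using conv[of a c b] by (simp add: interval_module_def)
  qed
qed

lemma persistence_module_direct_sum: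
  fixes A :: "'i set"
  assumes s: "vector_space s" and M: "\<And>i. i \<in> A \<Longrightarrow> persistence_module s (M i)"
  shows "persistence_module (fun_scale s) (direct_sum A M)"
proof -
  interpret vector_space s by fact
  interpret F: module "fun_scale s :: _ \<Rightarrow> ('i \<Rightarrow> _) \<Rightarrow> _"
    using s by (rule module_fun_scale)
  have sub: "subspace (obj (M i) a)" if "i \<in> A" for i a
    using M[OF that] by (auto simp: persistence_module_def)
  have lin: "linear_between s s (obj (M i) a) (obj (M i) b) (arr (M i) a b)"
    if "i \<in> A" "a \<le> b" for i a b
    using M[OF that(1)] that(2) by (auto simp: persistence_module_def)
  have ident: "arr (M i) a a x = x" if "i \<in> A" "x \<in> obj (M i) a" for i a x
    using M[OF that(1)] that(2) by (auto simp: persistence_module_def)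
  have comp: "arr (M i) b c (arr (M i) a b x) = arr (M i) a c x"
    if "i \<in> A" "a \<le> b" "b \<le> c" "x \<in> obj (M i) a" for i a b c x
    using M[OF that(1)] that(2-) unfolding persistence_module_def by blast
  have arr0: "arr (M i) a b 0 = 0" if "i \<in> A" "a \<le> b" for i a b
  proof -
    have "0 \<in> obj (M i) a"
      using sub[OF that(1)] subspace_0 by blast
    then have "arr (M i) a b (s 0 0) = s 0 (arr (M i) a b 0)"
      using lin[OF that] unfolding linear_between_def by blast
    then show ?thesis by simp
  qed
  have S: "F.subspace (obj (direct_sum A M) a)" for a
  proof (rule F.subspaceI)
    show "0 \<in> obj (direct_sum A M) a"
      by (auto simp: direct_sum_def sub subspace_0)
  next
    fix f g assume f: "f \<in> obj (direct_sum A M) a" and g: "g \<in> obj (direct_sum A M) a"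
    have "{i. f i + g i \<noteq> 0} \<subseteq> {i. f i \<noteq> 0} \<union> {i. g i \<noteq> 0}" by auto
    then have "finite {i. f i + g i \<noteq> 0}"
      using f g by (auto simp: direct_sum_def intro: finite_subset)
    then show "f + g \<in> obj (direct_sum A M) a"
      using f g by (auto simp: direct_sum_def sub subspace_add)
  next
    fix c f assume f: "f \<in> obj (direct_sum A M) a"
    have "{i. s c (f i) \<noteq> 0} \<subseteq> {i. f i \<noteq> 0}" by auto
    then have "finite {i. s c (f i) \<noteq> 0}"
      using f by (auto simp: direct_sum_def intro: finite_subset)
    then show "fun_scale s c f \<in> obj (direct_sum A M) a"
      using f by (auto simp: direct_sum_def fun_scale_def sub subspace_scale)
  qed
  have L: "linear_between (fun_scale s) (fun_scale s) (obj (direct_sum A M) a)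
             (obj (direct_sum A M) b) (arr (direct_sum A M) a b)" if ab: "a \<le> b" for a b
    unfolding linear_between_def
  proof (intro conjI ballI allI)
    show "arr (direct_sum A M) a b ` obj (direct_sum A M) a \<subseteq> obj (direct_sum A M) b"
    proof
      fix g assume "g \<in> arr (direct_sum A M) a b ` obj (direct_sum A M) a"
      then obtain f where f: "f \<in> obj (direct_sum A M) a"
        and g: "g = (\<lambda>i. if i \<in> A then arr (M i) a b (f i) else 0)"
        by (auto simp: direct_sum_def)
      have "{i. g i \<noteq> 0} \<subseteq> {i. f i \<noteq> 0}"
        using arr0 ab by (auto simp: g)
      then have "finite {i. g i \<noteq> 0}"
        using f by (auto simp: direct_sum_def intro: finite_subset)
      moreover have "g i \<in> obj (M i) b" if "i \<in> A" for i
        using lin[OF that ab] f that by (auto simp: direct_sum_def linear_between_def g)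
      ultimately show "g \<in> obj (direct_sum A M) b"
        by (auto simp: direct_sum_def g)
    qed
  next
    fix f g assume "f \<in> obj (direct_sum A M) a" "g \<in> obj (direct_sum A M) a"
    then show "arr (direct_sum A M) a b (f + g)
                 = arr (direct_sum A M) a b f + arr (direct_sum A M) a b g"
      using lin[OF _ ab] by (auto simp: direct_sum_def linear_between_def fun_eq_iff)
  next
    fix c f assume "f \<in> obj (direct_sum A M) a"
    then show "arr (direct_sum A M) a b (fun_scale s c f)
                 = fun_scale s c (arr (direct_sum A M) a b f)"
      using lin[OF _ ab] by (auto simp: direct_sum_def linear_between_def fun_scale_def fun_eq_iff)
  qed
  have I: "arr (direct_sum A M) a a f = f" if "f \<in> obj (direct_sum A M) a" for a f
    using that ident by (auto simp: direct_sum_def fun_eq_iff)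
  have C: "arr (direct_sum A M) b c (arr (direct_sum A M) a b f) = arr (direct_sum A M) a c f"
    if "a \<le> b" "b \<le> c" "f \<in> obj (direct_sum A M) a" for a b c f
    using that comp by (auto simp: direct_sum_def fun_eq_iff)
  show ?thesis
    unfolding persistence_module_def using S L I C by blast
qed

lemma pmod_isomorphic_refl:
  assumes "persistence_module s M"
  shows "pmod_isomorphic s s M M"
  using assms unfolding pmod_isomorphic_def persistence_module_def pmod_morphism_def
    linear_between_def by (intro exI[of _ "\<lambda>_ x. x"]) (auto simp: bij_betw_def)

lemma pmod_isomorphic_sym:
  assumes s: "vector_space s" and M: "persistence_module s M"
    and iso: "pmod_isomorphic s t M N"
  shows "pmod_isomorphic t s N M"
proof -
  interpret vector_space s by fact
  obtain \<phi> where \<phi>: "pmod_morphism s t M N \<phi>" and bij: "\<And>a. bij_betw (\<phi> a) (obj M a) (obj N a)"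
    using iso unfolding pmod_isomorphic_def by blast
  define \<psi> where "\<psi> a = inv_into (obj M a) (\<phi> a)" for a
  have sub: "subspace (obj M a)" for a
    using M by (simp add: persistence_module_def)
  have add: "\<phi> a (x + y) = \<phi> a x + \<phi> a y" if "x \<in> obj M a" "y \<in> obj M a" for a x y
    using \<phi> that unfolding pmod_morphism_def linear_between_def by blast
  have scal: "\<phi> a (s c x) = t c (\<phi> a x)" if "x \<in> obj M a" for a c x
    using \<phi> that unfolding pmod_morphism_def linear_between_def by blast
  have nat: "\<phi> b (arr M a b x) = arr N a b (\<phi> a x)" if "a \<le> b" "x \<in> obj M a" for a b x
    using \<phi> that unfolding pmod_morphism_def by blast
  have arr: "arr M a b x \<in> obj M b" if "a \<le> b" "x \<in> obj M a" for a b x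
    using M that unfolding persistence_module_def linear_between_def by blast
  have mem: "\<psi> a y \<in> obj M a" "\<phi> a (\<psi> a y) = y" if "y \<in> obj N a" for a y
    using bij[of a] that unfolding \<psi>_def bij_betw_def
    by (auto intro: inv_into_into f_inv_into_f)
  have inv: "\<psi> a y = x" if "x \<in> obj M a" "\<phi> a x = y" for a x y
    using bij[of a] that unfolding \<psi>_def bij_betw_def by (auto simp: inv_into_f_f)
  have "pmod_morphism t s N M \<psi>"
    unfolding pmod_morphism_def linear_between_def
  proof (intro conjI allI ballI impI)
    show "\<psi> a ` obj N a \<subseteq> obj M a" for a
      using mem by blast
    show "\<psi> a (x + y) = \<psi> a x + \<psi> a y" if "x \<in> obj N a" "y \<in> obj N a" for a x y
      using that mem by (intro inv) (simp_all add: sub subspace_add add)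
    show "\<psi> a (t c x) = s c (\<psi> a x)" if "x \<in> obj N a" for a c x
      using that mem by (intro inv) (simp_all add: sub subspace_scale scal)
    show "\<psi> b (arr N a b x) = arr M a b (\<psi> a x)" if "a \<le> b" "x \<in> obj N a" for a b x
      using that mem by (intro inv) (simp_all add: arr nat)
  qed
  moreover have "bij_betw (\<psi> a) (obj N a) (obj M a)" for a
    unfolding \<psi>_def by (rule bij_betw_inv_into[OF bij])
  ultimately show ?thesis
    unfolding pmod_isomorphic_def by blast
qed

lemma pmod_isomorphic_trans:
  assumes "pmod_isomorphic s t M N" "pmod_isomorphic t u N P"
  shows "pmod_isomorphic s u M P"
proof -
  obtain \<phi> \<psi> where m: "pmod_morphism s t M N \<phi>" "pmod_morphism t u N P \<psi>"
    and b: "\<And>a. bij_betw (\<phi> a) (obj M a) (obj N a)" "\<And>a. bij_betw (\<psi> a) (obj N a) (obj P a)"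
    using assms unfolding pmod_isomorphic_def by blast
  have lin: "linear_between s t (obj M a) (obj N a) (\<phi> a)"
    "linear_between t u (obj N a) (obj P a) (\<psi> a)" for a
    using m unfolding pmod_morphism_def by blast+
  have mem: "\<phi> a x \<in> obj N a" if "x \<in> obj M a" for a x
    using lin(1) that unfolding linear_between_def by blast
  have "linear_between s u (obj M a) (obj P a) (\<psi> a \<circ> \<phi> a)" for a
    using lin[of a] mem unfolding linear_between_def by (simp add: image_subset_iff)
  then have "pmod_morphism s u M P (\<lambda>a. \<psi> a \<circ> \<phi> a)"
    using m mem unfolding pmod_morphism_def by simp
  moreover have "bij_betw (\<psi> a \<circ> \<phi> a) (obj M a) (obj P a)" for a
    using b by (rule bij_betw_trans)
  ultimately show ?thesis
    unfolding pmod_isomorphic_def by (intro exI[of _ "\<lambda>a. \<psi> a \<circ> \<phi> a"]) simp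
qed

lemma equiv_iso_rel:
  "equiv {M. persistence_module (uscale :: 'k::field \<Rightarrow> _) M} iso_rel"
proof (rule equivI)
  have u: "vector_space (uscale :: 'k \<Rightarrow> _)"
    by (rule vector_space_fun_scale) unfold_locales
  show "sym (iso_rel :: ((real \<Rightarrow> 'k) pmod \<times> _) set)"
    unfolding iso_rel_def by (auto intro!: symI pmod_isomorphic_sym[OF u])
qed (auto simp: iso_rel_def refl_on_def intro!: transI pmod_isomorphic_refl
       intro: pmod_isomorphic_trans)

end

theory Submission
  imports Defs
begin

text \<open>
  Every neighbourhood of the zero module is too large to be compact.  Let $J = [c, c+h]$ with
  $0 < h \le d - c$, and let $J^n$ be the direct sum of $n$ copies of $J$; it lies in all seven
  sets.  Since $J$ is short, $J^n$ is $h$-interleaved with the zero module, so all the $J^n$ lie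
  near zero when $h$ is small.  On the other hand they are uniformly separated: in an
  $\varepsilon$-interleaving of $J^m$ with $J^n$ with $2\varepsilon \le h$, the identity
  $J^m(c) \to J^m(c + 2\varepsilon)$ of an $m$-dimensional space factors through the
  $n$-dimensional space $J^n(c+\varepsilon)$, whence $m \le n$, and by symmetry $m = n$
  (\<open>card_le_of_interleaved\<close>).  So any ball around zero contains infinitely many points at
  mutual distance at least $h/2$, which no compact set can contain.

  The last step is a fact about extended pseudometrics
  (\<open>not_locally_compact_if_separated_sets\<close>).  To apply it, the triangle inequality for the
  interleaving distance is needed, both between modules (\<open>interleaved_trans\<close>) and across the
  choice of representatives of isomorphism classes (\<open>interleaved_zero_if_isomorphic\<close>).
\<close>


section \<open>Extended pseudometrics and local compactness\<close>

text \<open>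
  A finite cover of the separated set by balls of half the separation would place two of its
  points in one ball.  The triangle inequality is stated for real radii, so that no
  arithmetic with infinite distances occurs.
\<close>

lemma not_locally_compact_if_separated_sets:
  fixes X :: "'a set" and d :: "'a \<Rightarrow> 'a \<Rightarrow> ereal"
  assumes refl: "\<And>x. x \<in> X \<Longrightarrow> d x x = 0"
    and sym: "\<And>x y. x \<in> X \<Longrightarrow> y \<in> X \<Longrightarrow> d x y = d y x"
    and tri: "\<And>x y z r s. x \<in> X \<Longrightarrow> y \<in> X \<Longrightarrow> z \<in> X \<Longrightarrow>
                d x y < ereal r \<Longrightarrow> d y z < ereal s \<Longrightarrow> d x z < ereal (r + s)"
    and p: "p \<in> X"
    and sep: "\<And>r. 0 < r \<Longrightarrow> \<exists>S \<delta>. infinite S \<and> S \<subseteq> {y \<in> X. d p y < ereal r} \<and> 0 < \<delta> \<and>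
                (\<forall>y\<in>S. \<forall>z\<in>S. y \<noteq> z \<longrightarrow> ereal \<delta> \<le> d y z)"
  shows "\<not> locally_compact_space
           (topology_generated_by {{y \<in> X. d x y < ereal r} | x r. x \<in> X \<and> 0 < r})"
    (is "\<not> locally_compact_space (topology_generated_by ?B)")
proof
  assume lc: "locally_compact_space (topology_generated_by ?B)"
  have top: "topspace (topology_generated_by ?B) = X"
  proof -
    have "x \<in> \<Union> ?B" if "x \<in> X" for x
      using that refl[OF that]
      by (intro UnionI[of "{y \<in> X. d x y < ereal 1}"] CollectI exI[of _ x] exI[of _ 1]) auto
    then show ?thesis by auto
  qed
  \<comment> \<open>The balls are only a subbase by definition; the triangle inequality makes them a base.\<close>
  have ball: "\<exists>r>0. {y \<in> X. d x y < ereal r} \<subseteq> U"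
    if "generate_topology_on ?B U" "x \<in> U" for U x
    using that
  proof (induction arbitrary: x rule: generate_topology_on.induct)
    case Empty
    then show ?case by simp
  next
    case (Int U V)
    have "x \<in> U" "x \<in> V" using Int.prems by auto
    obtain r where r: "0 < r" "{y \<in> X. d x y < ereal r} \<subseteq> U"
      using Int.IH(1)[OF \<open>x \<in> U\<close>] by blast
    obtain s where s: "0 < s" "{y \<in> X. d x y < ereal s} \<subseteq> V"
      using Int.IH(2)[OF \<open>x \<in> V\<close>] by blast
    have "{y \<in> X. d x y < ereal (min r s)} \<subseteq> U \<inter> V"
    proof
      fix y assume "y \<in> {y \<in> X. d x y < ereal (min r s)}"
      then have "y \<in> X" "d x y < ereal r" "d x y < ereal s"
        by (auto intro: less_le_trans)
      then show "y \<in> U \<inter> V" using r(2) s(2) by blast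
    qed
    then show ?case using r(1) s(1) by (metis min_less_iff_conj)
  next
    case (UN K)
    obtain U where U: "U \<in> K" "x \<in> U" using UN.prems by blast
    obtain r where "0 < r" "{y \<in> X. d x y < ereal r} \<subseteq> U"
      using UN.IH[OF U] by blast
    then show ?case using U(1) by blast
  next
    case (Basis V)
    then obtain z r where z: "z \<in> X" and V: "V = {y \<in> X. d z y < ereal r}" by blast
    then have x: "x \<in> X" "d z x < ereal r" using Basis by auto
    obtain t where t: "d z x < ereal t" "ereal t < ereal r"
      using ereal_dense2[OF x(2)] by blast
    then have "d z y < ereal r" if "y \<in> X" "d x y < ereal (r - t)" for y
      using tri[OF z x(1) that(1) t(1) that(2)] by simp
    then show ?case
      using t(2) by (intro exI[of _ "r - t"]) (auto simp: V)
  qed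
  obtain U K where U: "openin (topology_generated_by ?B) U" "p \<in> U" "U \<subseteq> K"
    and K: "compactin (topology_generated_by ?B) K"
    using lc p unfolding locally_compact_space_def top by blast
  have "generate_topology_on ?B U"
    using U(1) unfolding openin_topology_generated_by_iff .
  then obtain r where "0 < r" and r: "{y \<in> X. d p y < ereal r} \<subseteq> U"
    using ball U(2) by blast
  obtain S \<delta> where S: "infinite S" "S \<subseteq> {y \<in> X. d p y < ereal r}" and \<delta>: "0 < \<delta>"
    and far: "\<And>y z. y \<in> S \<Longrightarrow> z \<in> S \<Longrightarrow> y \<noteq> z \<Longrightarrow> ereal \<delta> \<le> d y z"
    using sep[OF \<open>0 < r\<close>] by metis
  define C where "C = (\<lambda>x. {y \<in> X. d x y < ereal (\<delta> / 2)}) ` X"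
  have "openin (topology_generated_by ?B) W" if "W \<in> C" for W
    using that \<delta> unfolding C_def
    by (intro topology_generated_by_Basis) (auto intro: half_gt_zero)
  moreover have "K \<subseteq> \<Union> C"
  proof
    fix x assume "x \<in> K"
    then have "x \<in> X" using compactin_subset_topspace[OF K] top by blast
    then show "x \<in> \<Union> C" unfolding C_def using refl[of x] \<delta> by (intro UN_I[of x]) auto
  qed
  ultimately obtain F where F: "finite F" "F \<subseteq> C" "K \<subseteq> \<Union> F"
    using K unfolding compactin_def by meson
  have "finite (W \<inter> S)" if WF: "W \<in> F" for W
  proof -
    obtain x where x: "x \<in> X" and W: "W = {y \<in> X. d x y < ereal (\<delta> / 2)}"
      using F(2) WF unfolding C_def by blast
    have "y = z" if yz: "y \<in> W \<inter> S" "z \<in> W \<inter> S" for y z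
    proof (rule ccontr)
      assume "y \<noteq> z"
      have "d y x < ereal (\<delta> / 2)" "d x z < ereal (\<delta> / 2)" "y \<in> X" "z \<in> X"
        using yz x sym by (auto simp: W)
      then have "d y z < ereal \<delta>"
        using tri[of y x z "\<delta> / 2" "\<delta> / 2"] x by simp
      then show False using far[of y z] yz \<open>y \<noteq> z\<close> by simp
    qed
    then have "W \<inter> S = {} \<or> (\<exists>y. W \<inter> S = {y})" by blast
    then show ?thesis by auto
  qed
  then have "finite (\<Union>W\<in>F. W \<inter> S)" using F(1) by blast
  moreover have "S \<subseteq> \<Union> F"
    using S(2) r U(3) F(3) by (meson order_trans)
  then have "S \<subseteq> (\<Union>W\<in>F. W \<inter> S)" by blast
  ultimately show False using S(1) finite_subset by blast
qed


section \<open>The interleaving distance is an extended pseudometric\<close>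

lemma interleaved_sym: "interleaved s t e M N \<Longrightarrow> interleaved t s e N M"
  unfolding interleaved_def by blast

lemma pmod_morphism_shift_comp:
  assumes "pmod_morphism s t M (shift e N) \<phi>" "pmod_morphism t u N (shift e' P) \<phi>'"
  shows "pmod_morphism s u M (shift (e + e') P) (\<lambda>a x. \<phi>' (a + e) (\<phi> a x))"
proof -
  have "linear_between s t (obj M a) (obj N (a + e)) (\<phi> a)"
    "linear_between t u (obj N (a + e)) (obj P (a + (e + e'))) (\<phi>' (a + e))" for a
    using assms by (simp_all add: pmod_morphism_def shift_def flip: add.assoc)
  moreover from this have mem: "\<phi> a x \<in> obj N (a + e)" if "x \<in> obj M a" for a x
    using that unfolding linear_between_def by blast
  ultimately have "linear_between s u (obj M a) (obj P (a + (e + e'))) (\<lambda>x. \<phi>' (a + e) (\<phi> a x))"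
    for a
    unfolding linear_between_def by (simp add: image_subset_iff)
  then show ?thesis
    using assms mem by (simp add: pmod_morphism_def shift_def flip: add.assoc)
qed

text \<open>
  One of the two round trips of a composite interleaving: the inner part \<open>\<psi>' \<circ> \<phi>'\<close> is a structure
  map of \<open>N\<close>, and naturality of \<open>\<psi>\<close> turns it into a structure map of \<open>M\<close> that follows the round
  trip \<open>\<psi> \<circ> \<phi>\<close>.
\<close>

lemma interleaving_round_trip_comp:
  assumes M: "persistence_module s M" and "0 \<le> e" "0 \<le> e'"
    and \<phi>: "pmod_morphism s t M (shift e N) \<phi>" and \<psi>: "pmod_morphism t s N (shift e M) \<psi>"
    and \<psi>\<phi>: "\<And>a x. x \<in> obj M a \<Longrightarrow> \<psi> (a + e) (\<phi> a x) = arr M a (a + 2 * e) x"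
    and \<psi>\<phi>': "\<And>a y. y \<in> obj N a \<Longrightarrow> \<psi>' (a + e') (\<phi>' a y) = arr N a (a + 2 * e') y"
    and x: "x \<in> obj M a"
  shows "\<psi> (a + (e + e') + e') (\<psi>' (a + (e + e')) (\<phi>' (a + e) (\<phi> a x)))
           = arr M a (a + 2 * (e + e')) x"
proof -
  have mem: "\<phi> a x \<in> obj N (a + e)"
    using \<phi> x by (simp add: pmod_morphism_def shift_def linear_between_def image_subset_iff)
  have "\<psi>' (a + (e + e')) (\<phi>' (a + e) (\<phi> a x)) = arr N (a + e) (a + e + 2 * e') (\<phi> a x)"
    using \<psi>\<phi>'[OF mem] by (simp add: add.assoc)
  moreover have "a + (e + e') + e' = a + e + 2 * e'" by simp
  moreover have "\<psi> (a + e + 2 * e') (arr N (a + e) (a + e + 2 * e') (\<phi> a x))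
                   = arr M (a + e + e) (a + e + 2 * e' + e) (\<psi> (a + e) (\<phi> a x))"
    using \<psi> mem \<open>0 \<le> e'\<close> by (simp add: pmod_morphism_def shift_def)
  moreover have "\<dots> = arr M (a + 2 * e) (a + 2 * (e + e')) (arr M a (a + 2 * e) x)"
    using \<psi>\<phi>[OF x] by (simp add: algebra_simps)
  moreover have "\<dots> = arr M a (a + 2 * (e + e')) x"
    using M x \<open>0 \<le> e\<close> \<open>0 \<le> e'\<close> by (simp add: persistence_module_def)
  ultimately show ?thesis by metis
qed

lemma interleaved_trans:
  assumes M: "persistence_module s M" and P: "persistence_module u P"
    and e: "0 \<le> e" "0 \<le> e'"
    and MN: "interleaved s t e M N" and NP: "interleaved t u e' N P"
  shows "interleaved s u (e + e') M P"
proof -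
  obtain \<phi> \<psi> where 1: "pmod_morphism s t M (shift e N) \<phi>" "pmod_morphism t s N (shift e M) \<psi>"
    "\<And>a x. x \<in> obj M a \<Longrightarrow> \<psi> (a + e) (\<phi> a x) = arr M a (a + 2 * e) x"
    "\<And>a y. y \<in> obj N a \<Longrightarrow> \<phi> (a + e) (\<psi> a y) = arr N a (a + 2 * e) y"
    using MN unfolding interleaved_def by blast
  obtain \<phi>' \<psi>' where 2: "pmod_morphism t u N (shift e' P) \<phi>'" "pmod_morphism u t P (shift e' N) \<psi>'"
    "\<And>a x. x \<in> obj N a \<Longrightarrow> \<psi>' (a + e') (\<phi>' a x) = arr N a (a + 2 * e') x"
    "\<And>a y. y \<in> obj P a \<Longrightarrow> \<phi>' (a + e') (\<psi>' a y) = arr P a (a + 2 * e') y"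
    using NP unfolding interleaved_def by blast
  have "pmod_morphism u s P (shift (e + e') M) (\<lambda>a x. \<psi> (a + e') (\<psi>' a x))"
    using pmod_morphism_shift_comp[OF 2(2) 1(2)] by (simp add: add.commute)
  moreover have "\<phi>' (a + (e + e') + e) (\<phi> (a + (e + e')) (\<psi> (a + e') (\<psi>' a y)))
                   = arr P a (a + 2 * (e + e')) y" if "y \<in> obj P a" for a y
    using interleaving_round_trip_comp[where \<phi> = \<psi>' and \<psi> = \<phi>' and \<phi>' = \<psi> and \<psi>' = \<phi>,
        OF P e(2,1) 2(2,1,4) 1(4) that]
    by (simp add: add.commute)
  ultimately show ?thesis
    unfolding interleaved_def
    using pmod_morphism_shift_comp[OF 1(1) 2(1)]
      interleaving_round_trip_comp[where \<phi> = \<phi> and \<psi> = \<psi> and \<phi>' = \<phi>' and \<psi>' = \<psi>',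
        OF M e 1(1,2,3) 2(3)]
    by (intro exI[of _ "\<lambda>a x. \<phi>' (a + e) (\<phi> a x)"] exI[of _ "\<lambda>a x. \<psi> (a + e') (\<psi>' a x)"]) blast
qed

lemma shift_zero: "shift 0 M = M"
  by (simp add: shift_def)

lemma interleaved_zero_if_isomorphic:
  assumes s: "vector_space s" and M: "persistence_module s M" and N: "persistence_module t N"
    and iso: "pmod_isomorphic s t M N"
  shows "interleaved s t 0 M N"
proof -
  interpret vector_space s by fact
  obtain \<phi> where \<phi>: "pmod_morphism s t M N \<phi>" and bij: "\<And>a. bij_betw (\<phi> a) (obj M a) (obj N a)"
    using iso unfolding pmod_isomorphic_def by blast
  define \<psi> where "\<psi> a = inv_into (obj M a) (\<phi> a)" for a
  have lin: "\<phi> a (x + y) = \<phi> a x + \<phi> a y" "\<phi> a (s c x) = t c (\<phi> a x)"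
    if "x \<in> obj M a" "y \<in> obj M a" for a c x y
    using \<phi> that unfolding pmod_morphism_def linear_between_def by blast+
  have nat: "\<phi> b (arr M a b x) = arr N a b (\<phi> a x)" if "a \<le> b" "x \<in> obj M a" for a b x
    using \<phi> that unfolding pmod_morphism_def by blast
  have closed: "x + y \<in> obj M a" "s c x \<in> obj M a" if "x \<in> obj M a" "y \<in> obj M a" for a c x y
    using M that by (simp_all add: persistence_module_def subspace_add subspace_scale)
  have arr: "arr M a b x \<in> obj M b" if "a \<le> b" "x \<in> obj M a" for a b x
    using M that unfolding persistence_module_def linear_between_def by blast
  have mem: "\<psi> a y \<in> obj M a" "\<phi> a (\<psi> a y) = y" if "y \<in> obj N a" for a y
    using bij_betw_apply[OF bij_betw_inv_into[OF bij[of a]] that]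
      bij_betw_inv_into_right[OF bij[of a] that] by (simp_all add: \<psi>_def)
  have inv: "\<psi> a y = x" if "x \<in> obj M a" "\<phi> a x = y" for a x y
    using bij_betw_inv_into_left[OF bij[of a]] that by (auto simp: \<psi>_def)
  have "pmod_morphism t s N M \<psi>"
    unfolding pmod_morphism_def linear_between_def
  proof (intro conjI allI ballI impI)
    show "\<psi> a ` obj N a \<subseteq> obj M a" for a
      using mem by blast
    show "\<psi> a (x + y) = \<psi> a x + \<psi> a y" if "x \<in> obj N a" "y \<in> obj N a" for a x y
      using that by (intro inv) (simp_all add: mem closed lin)
    show "\<psi> a (t c x) = s c (\<psi> a x)" if "x \<in> obj N a" for a c x
      using that mem closed(2) lin(2) by (metis inv)
    show "\<psi> b (arr N a b x) = arr M a b (\<psi> a x)" if "a \<le> b" "x \<in> obj N a" for a b x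
      using that by (intro inv) (simp_all add: mem arr nat)
  qed
  moreover have "arr M a a x = x" if "x \<in> obj M a" for a x
    using M that by (simp add: persistence_module_def)
  moreover have "arr N a a y = y" if "y \<in> obj N a" for a y
    using N that by (simp add: persistence_module_def)
  ultimately show ?thesis
    unfolding interleaved_def shift_zero using \<phi> mem(2) inv
    by (intro exI[of _ \<phi>] exI[of _ \<psi>]) auto
qed

lemma vector_space_uscale: "vector_space (uscale :: 'k::field \<Rightarrow> _)"
  by (rule vector_space_fun_scale) unfold_locales

lemma interleaved_zero_refl:
  assumes "persistence_module (uscale :: 'k::field \<Rightarrow> _) M"
  shows "interleaved uscale uscale 0 M M"
  using interleaved_zero_if_isomorphic[OF vector_space_uscale assms assms]
    pmod_isomorphic_refl[OF assms] .

text \<open>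
  Passing to other representatives costs a $0$-interleaving at either end, so the distance of two
  classes can be read off any pair of representatives.
\<close>

lemma interleaving_dist_less_iff:
  fixes M N :: "(real \<Rightarrow> 'k::field) pmod"
  assumes M: "persistence_module uscale M" and N: "persistence_module uscale N"
  shows "interleaving_dist (iso_class M) (iso_class N) < ereal r \<longleftrightarrow>
           (\<exists>e. 0 \<le> e \<and> e < r \<and> interleaved uscale uscale e M N)"
proof -
  have "interleaved uscale uscale e M N"
    if e: "0 \<le> e" and M': "M' \<in> iso_class M" and N': "N' \<in> iso_class N"
      and il: "interleaved uscale uscale e M' N'" for e M' N'
  proof -
    have p: "persistence_module uscale M'" "persistence_module uscale N'"
      and i: "pmod_isomorphic uscale uscale M M'" "pmod_isomorphic uscale uscale N N'"
      using M' N' by (auto simp: iso_class_def iso_rel_def)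
    have z: "interleaved uscale uscale 0 M M'" "interleaved uscale uscale 0 N' N"
      using interleaved_zero_if_isomorphic[OF vector_space_uscale M p(1) i(1)]
        interleaved_sym[OF interleaved_zero_if_isomorphic[OF vector_space_uscale N p(2) i(2)]]
      by simp_all
    have "interleaved uscale uscale (0 + e) M N'"
      using e by (intro interleaved_trans[OF M p(2) _ _ z(1) il]) auto
    then have "interleaved uscale uscale (0 + e + 0) M N"
      using e by (intro interleaved_trans[OF M N _ _ _ z(2)]) auto
    then show ?thesis by simp
  qed
  moreover have "M \<in> iso_class M" "N \<in> iso_class N"
    using M N by (auto simp: iso_class_def iso_rel_def intro: pmod_isomorphic_refl)
  ultimately have "(\<exists>M'\<in>iso_class M. \<exists>N'\<in>iso_class N. interleaved uscale uscale e M' N') \<longleftrightarrow>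
      interleaved uscale uscale e M N" if "0 \<le> e" for e
    using that by metis
  then have "{ereal e | e. 0 \<le> e \<and>
        (\<exists>M'\<in>iso_class M. \<exists>N'\<in>iso_class N. interleaved uscale uscale e M' N')}
      = {ereal e | e. 0 \<le> e \<and> interleaved uscale uscale e M N}"
    by (intro Collect_cong) metis
  then show ?thesis
    unfolding interleaving_dist_def by (auto simp: Inf_less_iff)
qed

lemma interleaving_dist_sym: "interleaving_dist C D = interleaving_dist D C"
  unfolding interleaving_dist_def by (rule arg_cong[of _ _ Inf]) (auto intro: interleaved_sym)

lemma interleaving_dist_refl:
  assumes "persistence_module (uscale :: 'k::field \<Rightarrow> _) M"
  shows "interleaving_dist (iso_class M) (iso_class M) = 0"
proof (rule antisym)
  show "0 \<le> interleaving_dist (iso_class M) (iso_class M)"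
    unfolding interleaving_dist_def by (rule Inf_greatest) auto
  have "M \<in> iso_class M"
    using assms by (auto simp: iso_class_def iso_rel_def intro: pmod_isomorphic_refl)
  then show "interleaving_dist (iso_class M) (iso_class M) \<le> 0"
    unfolding interleaving_dist_def using interleaved_zero_refl[OF assms]
    by (intro Inf_lower) (auto simp: zero_ereal_def)
qed

lemma interleaving_dist_triangle:
  fixes M N P :: "(real \<Rightarrow> 'k::field) pmod"
  assumes p: "persistence_module uscale M" "persistence_module uscale N"
      "persistence_module uscale P"
    and MN: "interleaving_dist (iso_class M) (iso_class N) < ereal r"
    and NP: "interleaving_dist (iso_class N) (iso_class P) < ereal s"
  shows "interleaving_dist (iso_class M) (iso_class P) < ereal (r + s)"
proof -
  obtain e e' where "0 \<le> e" "e < r" "interleaved uscale uscale e M N"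
    "0 \<le> e'" "e' < s" "interleaved uscale uscale e' N P"
    using MN NP p by (auto simp: interleaving_dist_less_iff)
  then have "interleaved uscale uscale (e + e') M P" "0 \<le> e + e'" "e + e' < r + s"
    using interleaved_trans[OF p(1,3)] by auto
  then show ?thesis
    using p by (auto simp: interleaving_dist_less_iff)
qed


section \<open>Direct sums of copies of one interval module\<close>

definition interval_power :: "'i set \<Rightarrow> real set \<Rightarrow> ('i \<Rightarrow> 'k::field) pmod" where
  "interval_power A J = direct_sum A (\<lambda>_. interval_module J)"

definition unit_fun :: "'i \<Rightarrow> 'i \<Rightarrow> 'k::field" where
  "unit_fun i = (\<lambda>j. if j = i then 1 else 0)"

lemma persistence_module_interval_sum:
  assumes "\<And>i. i \<in> A \<Longrightarrow> is_interval (J i)"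
  shows "persistence_module uscale (direct_sum A (\<lambda>i. interval_module (J i) :: 'k::field pmod))"
  using assms
  by (intro persistence_module_direct_sum persistence_module_interval) (auto, unfold_locales)

lemma persistence_module_interval_power:
  "is_interval J \<Longrightarrow> persistence_module uscale (interval_power A J :: (real \<Rightarrow> 'k::field) pmod)"
  unfolding interval_power_def by (rule persistence_module_interval_sum)

lemma interval_power_empty: "interval_power {} J = interval_power {} J'"
  by (simp add: interval_power_def direct_sum_def)

lemma obj_interval_power:
  assumes "a \<in> J" "finite A"
  shows "obj (interval_power A J) a = {f. \<forall>i. i \<notin> A \<longrightarrow> f i = 0}"
proof -
  have "finite {i. f i \<noteq> 0}" if "\<forall>i. i \<notin> A \<longrightarrow> f i = 0" for f :: "'a \<Rightarrow> 'b"
    by (rule finite_subset[OF _ assms(2)]) (use that in auto)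
  then show ?thesis
    using assms(1) by (auto simp: interval_power_def direct_sum_def interval_module_def)
qed

lemma arr_interval_power:
  assumes "a \<in> J" "b \<in> J" "\<forall>i. i \<notin> A \<longrightarrow> f i = 0"
  shows "arr (interval_power A J) a b f = f"
  using assms by (auto simp: interval_power_def direct_sum_def interval_module_def)

lemma in_span_unit_fun:
  fixes f :: "real \<Rightarrow> 'k::field"
  assumes "finite A" "\<forall>i. i \<notin> A \<longrightarrow> f i = 0"
  shows "f \<in> module.span uscale (unit_fun ` A)"
proof -
  interpret vector_space "uscale :: 'k \<Rightarrow> _" by (rule vector_space_uscale)
  show ?thesis
    using assms
  proof (induction A arbitrary: f rule: finite_induct)
    case empty
    then have "f = 0" by auto
    then show ?case by (simp only: span_zero)
  next
    case (insert k A)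
    have "f(k := 0) \<in> span (unit_fun ` A)"
      by (rule insert.IH) (use insert.prems in auto)
    then have "f(k := 0) \<in> span (unit_fun ` insert k A)"
      using span_mono[of "unit_fun ` A" "unit_fun ` insert k A"] by auto
    moreover have "uscale (f k) (unit_fun k) \<in> span (unit_fun ` insert k A)"
      by (intro span_scale span_base) simp
    ultimately have "f(k := 0) + uscale (f k) (unit_fun k) \<in> span (unit_fun ` insert k A)"
      by (rule span_add)
    moreover have "f(k := 0) + uscale (f k) (unit_fun k) = f"
      by (auto simp: fun_eq_iff fun_scale_def unit_fun_def)
    ultimately show ?case by (simp only:)
  qed
qed

text \<open>
  The functions vanishing at \<open>i\<close> form a subspace that contains every unit function except the one
  at \<open>i\<close>.
\<close>

lemma independent_unit_fun:
  "\<not> module.dependent uscale (unit_fun ` A :: (real \<Rightarrow> 'k::field) set)"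
proof -
  interpret vector_space "uscale :: 'k \<Rightarrow> _" by (rule vector_space_uscale)
  show ?thesis
    unfolding dependent_def
  proof clarify
    fix i assume "(unit_fun i :: real \<Rightarrow> 'k) \<in> span (unit_fun ` A - {unit_fun i})"
    moreover have "span (unit_fun ` A - {unit_fun i}) \<subseteq> {f :: real \<Rightarrow> 'k. f i = 0}"
      by (rule span_minimal, auto simp: unit_fun_def)
        (rule subspaceI, auto simp: fun_scale_def)
    ultimately show False by (auto simp: unit_fun_def)
  qed
qed

lemma inj_unit_fun: "inj (unit_fun :: 'i \<Rightarrow> 'i \<Rightarrow> 'k::field)"
  by (rule injI) (metis unit_fun_def zero_neq_one)

text \<open>
  If the interval contains a parameter together with its translates by $e$ and $2e$, then
  the round trip of the interleaving is the identity on an $|A|$-dimensional space and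
  factors through a $|B|$-dimensional one.  Its image is thus spanned by the $|B|$ images of the
  unit functions, yet contains the $|A|$ independent unit functions.
\<close>

lemma card_le_of_interleaved:
  fixes A B :: "real set"
  assumes fin: "finite A" "finite B" and J: "a \<in> J" "a + e \<in> J" "a + 2 * e \<in> J"
    and il: "interleaved (uscale :: 'k::field \<Rightarrow> _) uscale e (interval_power A J)
               (interval_power B J)"
  shows "card A \<le> card B"
proof -
  interpret vector_space "uscale :: 'k \<Rightarrow> _" by (rule vector_space_uscale)
  define V where "V = {f :: real \<Rightarrow> 'k. \<forall>i. i \<notin> A \<longrightarrow> f i = 0}"
  define W where "W = {f :: real \<Rightarrow> 'k. \<forall>i. i \<notin> B \<longrightarrow> f i = 0}"
  have obj: "obj (interval_power A J) a = V" "obj (interval_power B J) (a + e) = W"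
    using J fin by (simp_all add: obj_interval_power V_def W_def)
  obtain \<phi> \<psi> where
    \<phi>: "pmod_morphism uscale uscale (interval_power A J) (shift e (interval_power B J)) \<phi>" and
    \<psi>: "pmod_morphism uscale uscale (interval_power B J) (shift e (interval_power A J)) \<psi>" and
    \<psi>\<phi>: "\<And>x. x \<in> V \<Longrightarrow> \<psi> (a + e) (\<phi> a x) = arr (interval_power A J) a (a + 2 * e) x"
    using il unfolding interleaved_def by (fold obj(1)) blast
  have \<phi>_mem: "\<phi> a f \<in> W" if "f \<in> V" for f
    using \<phi> that
    by (simp add: pmod_morphism_def linear_between_def shift_def image_subset_iff flip: obj)
  have lin: "\<psi> (a + e) (f + g) = \<psi> (a + e) f + \<psi> (a + e) g"
    "\<psi> (a + e) (uscale k f) = uscale k (\<psi> (a + e) f)" if "f \<in> W" "g \<in> W" for f g k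
    using \<psi> that unfolding pmod_morphism_def linear_between_def obj(2)[symmetric] by blast+
  have zero: "\<psi> (a + e) 0 = 0"
    using lin(2)[of 0 0 0] by (simp add: W_def)
  have unit_W: "unit_fun i \<in> W" if "i \<in> B" for i
    using that by (auto simp: unit_fun_def W_def)
  let ?T = "\<psi> (a + e) ` unit_fun ` B"
  have "f \<in> W \<and> \<psi> (a + e) f \<in> span ?T" if "f \<in> span (unit_fun ` B)" for f
    using that
  proof (induction rule: span_induct_alt)
    case base
    have "0 \<in> W" by (simp add: W_def)
    then show ?case by (simp only: zero span_zero simp_thms)
  next
    case (step k u f)
    then have u: "u \<in> W" "\<psi> (a + e) u \<in> span ?T" and f: "f \<in> W" "\<psi> (a + e) f \<in> span ?T"
      using unit_W by (auto intro: span_base)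
    have sum: "uscale k u \<in> W" "uscale k u + f \<in> W"
      using u(1) f(1) by (auto simp: W_def fun_scale_def)
    have "\<psi> (a + e) (uscale k u + f) = uscale k (\<psi> (a + e) u) + \<psi> (a + e) f"
      by (simp only: lin(1)[OF sum(1) f(1)] lin(2)[OF u(1) u(1)])
    moreover have "uscale k (\<psi> (a + e) u) + \<psi> (a + e) f \<in> span ?T"
      by (intro span_add span_scale u(2) f(2))
    ultimately show ?case using sum(2) by (simp only: simp_thms)
  qed
  then have image: "\<psi> (a + e) f \<in> span ?T" if "f \<in> W" for f
    using in_span_unit_fun[OF fin(2)] that by (auto simp: W_def)
  have "unit_fun ` A \<subseteq> span ?T"
  proof clarify
    fix i assume "i \<in> A"
    then have i: "unit_fun i \<in> V" by (auto simp: unit_fun_def V_def)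
    then have "\<psi> (a + e) (\<phi> a (unit_fun i)) = unit_fun i"
      using \<psi>\<phi> arr_interval_power[OF J(1,3)] by (simp add: V_def)
    then show "unit_fun i \<in> span ?T" using image[OF \<phi>_mem[OF i]] by simp
  qed
  moreover have "finite ?T"
    using fin(2) by simp
  ultimately have "card (unit_fun ` A :: (real \<Rightarrow> 'k) set) \<le> card ?T"
    using independent_span_bound[OF _ independent_unit_fun] by metis
  also have "\<dots> \<le> card B"
    unfolding image_image by (rule card_image_le[OF fin(2)])
  finally show ?thesis
    by (simp add: card_image inj_on_subset[OF inj_unit_fun])
qed

text \<open>
  No point of \<open>J\<close> survives a shift by $2e$, so both round trips have to be zero, and zero maps form
  an interleaving.
\<close>

lemma interleaved_interval_power_empty:
  assumes J: "\<And>a. a \<in> J \<Longrightarrow> a + 2 * e \<notin> J"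
  shows "interleaved uscale uscale e (interval_power {} J)
           (interval_power A J :: (real \<Rightarrow> 'k::field) pmod)"
proof -
  have A: "(\<lambda>_. 0) \<in> obj (interval_power A J :: (real \<Rightarrow> 'k) pmod) a"
    "arr (interval_power A J :: (real \<Rightarrow> 'k) pmod) a b (\<lambda>_. 0) = (\<lambda>_. 0)"
    "arr (interval_power A J :: (real \<Rightarrow> 'k) pmod) a (a + 2 * e) f = (\<lambda>_. 0)" for A a b f
    using J by (auto simp: interval_power_def direct_sum_def interval_module_def fun_eq_iff)
  show ?thesis
    unfolding interleaved_def
    by (intro exI[of _ "\<lambda>_ _ _. 0"])
      (auto simp: pmod_morphism_def linear_between_def shift_def A fun_scale_def fun_eq_iff)
qed


section \<open>Failure of local compactness\<close>

text \<open>
  The common reason for all seven cases: the criterion applied at the zero module with the powers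
  of a short interval starting at \<open>c\<close>.
\<close>

lemma not_locally_compact_interleaving_topology:
  fixes X :: "'k::field pclass set"
  assumes "c < d"
    and classes: "X \<subseteq> iso_class ` {M. persistence_module uscale M}"
    and powers: "\<And>A h. finite A \<Longrightarrow> 0 < h \<Longrightarrow> h \<le> d - c \<Longrightarrow>
                   iso_class (interval_power A {c..c + h}) \<in> X"
  shows "\<not> locally_compact_space (interleaving_topology X)"
  unfolding interleaving_topology_def
proof (rule not_locally_compact_if_separated_sets[where
      p = "iso_class (interval_power {} {c..d})"])
  show "iso_class (interval_power {} {c..d}) \<in> X"
    using powers[of "{}" "d - c"] \<open>c < d\<close> by simp
next
  show "interleaving_dist C C = 0" if "C \<in> X" for C
    using that classes interleaving_dist_refl by blast
next
  show "interleaving_dist C D = interleaving_dist D C" for C D :: "'k pclass"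
    by (rule interleaving_dist_sym)
next
  fix C D E and r s :: real
  assume X: "C \<in> X" "D \<in> X" "E \<in> X"
    and d: "interleaving_dist C D < ereal r" "interleaving_dist D E < ereal s"
  have rep: "\<exists>M. persistence_module uscale M \<and> C = iso_class M" if "C \<in> X" for C
    using classes that by blast
  obtain M N P where
    "persistence_module uscale M" "persistence_module uscale N" "persistence_module uscale P"
    "C = iso_class M" "D = iso_class N" "E = iso_class P"
    using rep[OF X(1)] rep[OF X(2)] rep[OF X(3)] by metis
  then show "interleaving_dist C E < ereal (r + s)"
    using interleaving_dist_triangle d by simp
next
  fix r :: real assume "0 < r"
  define h where "h = min (r / 2) (d - c)"
  have h: "0 < h" "h < r" "h \<le> d - c"
    using \<open>0 < r\<close> \<open>c < d\<close> by (auto simp: h_def min_def)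
  define M :: "nat \<Rightarrow> (real \<Rightarrow> 'k) pmod"
    where "M n = interval_power (real ` {..<n}) {c..c + h}" for n
  have pm: "persistence_module uscale (M n)" for n
    unfolding M_def by (intro persistence_module_interval_power is_interval_cc)
  have far: "ereal (h / 2) \<le> interleaving_dist (iso_class (M m)) (iso_class (M n))"
    if "m \<noteq> n" for m n
  proof (rule ccontr)
    assume "\<not> ?thesis"
    then obtain e where e: "0 \<le> e" "e < h / 2" and il: "interleaved uscale uscale e (M m) (M n)"
      by (auto simp: not_le interleaving_dist_less_iff[OF pm pm])
    have "k \<le> l" if "interleaved uscale uscale e (M k) (M l)" for k l
      using card_le_of_interleaved[of "real ` {..<k}" "real ` {..<l}" c "{c..c + h}" e] e that
      by (simp add: M_def card_image)
    from this[OF il] this[OF interleaved_sym[OF il]] show False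
      using \<open>m \<noteq> n\<close> by simp
  qed
  have "inj (\<lambda>n. iso_class (M n))"
  proof (rule injI, rule ccontr)
    fix m n assume "iso_class (M m) = iso_class (M n)" "m \<noteq> n"
    then show False
      using far[of m n] interleaving_dist_refl[OF pm[of n]] h(1) by simp
  qed
  then have "infinite (range (\<lambda>n. iso_class (M n)))"
    by (rule range_inj_infinite)
  moreover have "interleaving_dist (iso_class (interval_power {} {c..d})) (iso_class (M n))
                   < ereal r" for n
  proof -
    have "interleaved uscale uscale h (M 0) (M n)"
      unfolding M_def using interleaved_interval_power_empty[of "{c..c + h}" h] h(1) by simp
    then have "interleaving_dist (iso_class (M 0)) (iso_class (M n)) < ereal r"
      using h unfolding interleaving_dist_less_iff[OF pm pm] by (intro exI[of _ h]) simp
    then show ?thesis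
      by (simp add: M_def interval_power_empty[of "{c..d}" "{c..c + h}"])
  qed
  moreover have "ereal (h / 2) \<le> interleaving_dist C D"
    if "C \<in> range (\<lambda>n. iso_class (M n))" "D \<in> range (\<lambda>n. iso_class (M n))" "C \<noteq> D" for C D
  proof -
    obtain m n where "C = iso_class (M m)" "D = iso_class (M n)"
      using \<open>C \<in> range _\<close> \<open>D \<in> range _\<close> by (elim rangeE)
    then show ?thesis
      using \<open>C \<noteq> D\<close> far[of m n] by metis
  qed
  moreover have "iso_class (M n) \<in> X" for n
    unfolding M_def using h by (intro powers) auto
  ultimately show "\<exists>S \<delta>. infinite S \<and>
      S \<subseteq> {D \<in> X. interleaving_dist (iso_class (interval_power {} {c..d})) D < ereal r} \<and>
      0 < \<delta> \<and> (\<forall>C\<in>S. \<forall>D\<in>S. C \<noteq> D \<longrightarrow> ereal \<delta> \<le> interleaving_dist C D)"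
    using h(1)
    by (intro exI[of _ "range (\<lambda>n. iso_class (M n))"] exI[of _ "h / 2"]) auto
qed

lemma not_locally_compact_interval_sums:
  assumes "c < d" and Q: "\<And>A. finite A \<Longrightarrow> Q A"
    and P: "\<And>h. 0 < h \<Longrightarrow> h \<le> d - c \<Longrightarrow> P {c..c + h}"
  shows "\<not> locally_compact_space (interleaving_topology (interval_sums Q P :: 'k::field pclass set))"
proof (rule not_locally_compact_interleaving_topology[OF \<open>c < d\<close>])
  show "(interval_sums Q P :: 'k pclass set) \<subseteq> iso_class ` {M. persistence_module uscale M}"
    unfolding interval_sums_def using persistence_module_interval_sum by blast
next
  fix A :: "real set" and h :: real assume "finite A" "0 < h" "h \<le> d - c"
  then show "iso_class (interval_power A {c..c + h}) \<in> (interval_sums Q P :: 'k pclass set)"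
    unfolding interval_sums_def interval_power_def mem_Collect_eq
    by (intro exI[of _ A] exI[of _ "\<lambda>_. {c..c + h}"]) (auto simp: Q P is_interval_cc)
qed

lemma not_locally_compact_pfd:
  "\<not> locally_compact_space (interleaving_topology (pfd :: 'k::field pclass set))"
proof (rule not_locally_compact_interleaving_topology[of 0 1])
  show "(pfd :: 'k pclass set) \<subseteq> iso_class ` {M. persistence_module uscale M}"
    unfolding pfd_def by blast
next
  fix A :: "real set" and h :: real assume A: "finite A"
  have "obj (interval_power A {0..0 + h} :: (real \<Rightarrow> 'k) pmod) a
          \<subseteq> module.span uscale (unit_fun ` A)" for a
  proof
    fix f assume "f \<in> obj (interval_power A {0..0 + h} :: (real \<Rightarrow> 'k) pmod) a"
    then have "\<forall>i. i \<notin> A \<longrightarrow> f i = 0"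
      by (simp add: interval_power_def direct_sum_def)
    then show "f \<in> module.span uscale (unit_fun ` A)"
      by (rule in_span_unit_fun[OF A])
  qed
  then show "iso_class (interval_power A {0..0 + h}) \<in> (pfd :: 'k pclass set)"
    unfolding pfd_def using A persistence_module_interval_power[OF is_interval_cc] by blast
qed simp

theorem corollary4p9:
  fixes c d :: real
  assumes "c < d"
  shows
    "\<not> locally_compact_space (interleaving_topology (ffid_within c d :: 'k::field pclass set)) \<and>
     \<not> locally_compact_space (interleaving_topology (ffid :: 'k pclass set)) \<and>
     \<not> locally_compact_space (interleaving_topology (fid :: 'k pclass set)) \<and>
     \<not> locally_compact_space (interleaving_topology (cfid :: 'k pclass set)) \<and>
     \<not> locally_compact_space (interleaving_topology (cid :: 'k pclass set)) \<and>
     \<not> locally_compact_space (interleaving_topology (pfd :: 'k pclass set)) \<and>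
     \<not> locally_compact_space (interleaving_topology (rid :: 'k pclass set))"
  unfolding ffid_within_def ffid_def fid_def cfid_def cid_def rid_def
  using assms
  by (intro conjI not_locally_compact_pfd not_locally_compact_interval_sums[of c d])
    (auto simp: countable_finite)

end
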